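(* Let $G$ be a connected graph on $n \geq 2$ vertices. Let $B = (G, \beta)$ and $B' = (G, \beta')$ be two bicolored graphs on $G$. Then there exists a string $w\in V(G)^*$ of length at most $\left\lfloor \frac{11n-3}{2}\right\rfloor$ such that $B_w = B'$.
   Context: Graphs are simple, undirected and labelled. A bicoloration of a graph $G=(V,E)$ is a mapping $\beta:V\to\{-1,1\}$, and a bicolored graph on $G$ is a pair $B=(G,\beta)$. Two bicolored graphs on the same vertex set are equal if they have the same edge set and the same coloring. $N_G(a)$ denotes the open neighborhood of $a$. For $a\in V$, the local complement $G_a$ is the graph on $V$ obtained from $G$ by toggling adjacency between every pair of distinct vertices of $N_G(a)$ (all other adjacencies are unchanged). The coloring $\beta_a$ is given by $\beta_a(x)=-\beta(x)$ if $x\in N_G(a)$ and $\beta_a(x)=\beta(x)$ otherwise. The local inversion of $B$ at $a$ is $B_a=(G_a,\beta_a)$. For a string $w\in V^*$ (a finite sequence of vertices, with length $|w|$), $B_w$ is defined inductively by $B_\varepsilon=B$ for the empty string $\varepsilon$, and $B_{w'a}=(B_{w'})_a$. *)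

theory Defs
  imports Complex_Main "HOL-Library.FuncSet" "Graph_Theory.Graph_Theory"
begin

definition neighborhood :: "'a pair_pre_digraph \<Rightarrow> 'a \<Rightarrow> 'a set" where
  "neighborhood G a = {x. (a, x) \<in> parcs G}"

definition neighbor_pairs :: "'a pair_pre_digraph \<Rightarrow> 'a \<Rightarrow> ('a \<times> 'a) set" where
  "neighbor_pairs G a =
     {(x, y). x \<in> neighborhood G a \<and> y \<in> neighborhood G a \<and> x \<noteq> y}"

definition local_complement :: "'a pair_pre_digraph \<Rightarrow> 'a \<Rightarrow> 'a pair_pre_digraph" where
  "local_complement G a =
     \<lparr> pverts = pverts G,
       parcs = (parcs G - neighbor_pairs G a) \<union> (neighbor_pairs G a - parcs G) \<rparr>"

text \<open>
  Colorings are extensional: they take the value \<open>undefined\<close> outside the vertex set.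
  Hence HOL equality of pairs (graph, coloring) is equality of bicolored graphs.
\<close>

definition bicolorations :: "'a pair_pre_digraph \<Rightarrow> ('a \<Rightarrow> int) set" where
  "bicolorations G = pverts G \<rightarrow>\<^sub>E {-1, 1}"

type_synonym 'a bicolored_graph = "'a pair_pre_digraph \<times> ('a \<Rightarrow> int)"

definition local_inversion :: "'a bicolored_graph \<Rightarrow> 'a \<Rightarrow> 'a bicolored_graph" where
  "local_inversion B a = (case B of (G, \<beta>) \<Rightarrow>
     (local_complement G a, \<lambda>x. if x \<in> neighborhood G a then - \<beta> x else \<beta> x))"

definition local_inversions :: "'a bicolored_graph \<Rightarrow> 'a list \<Rightarrow> 'a bicolored_graph" where
  "local_inversions B w = foldl local_inversion B w"

lemma local_inversions_Nil: "local_inversions B [] = B"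
  by (simp add: local_inversions_def)

lemma local_inversions_snoc:
  "local_inversions B (w @ [a]) = local_inversion (local_inversions B w) a"
  by (simp add: local_inversions_def)

lemma pair_graph_local_complement:
  assumes "pair_graph G"
  shows "pair_graph (local_complement G a)"
proof -
  interpret pair_graph G by fact
  have wf: "x \<in> pverts G" "y \<in> pverts G" "(y, x) \<in> parcs G"
    if "(x, y) \<in> parcs G" for x y
    using that in_arcsD1 in_arcsD2 arcs_symmetric by blast+
  have irrefl: "(x, x) \<notin> parcs G" for x
    using no_loops' by blast
  show ?thesis
  proof
    show "finite (pverts (local_complement G a))"
      by (simp add: local_complement_def)
    have "parcs (local_complement G a) \<subseteq> pverts G \<times> pverts G"
      using wf by (auto simp: local_complement_def neighbor_pairs_def neighborhood_def)
    then show "finite (parcs (local_complement G a))"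
      using finite_subset by fastforce
    show "symmetric (with_proj (local_complement G a))"
      using wf
      by (auto simp: symmetric_def sym_def
            local_complement_def neighbor_pairs_def)
  qed (use wf irrefl in \<open>auto simp: local_complement_def neighbor_pairs_def neighborhood_def\<close>)
qed

lemma local_inversion_bicoloration:
  assumes "pair_graph G" "\<beta> \<in> bicolorations G" "local_inversion (G, \<beta>) a = (G', \<beta>')"
  shows "\<beta>' \<in> bicolorations G'"
proof -
  interpret pair_graph G by fact
  have "neighborhood G a \<subseteq> pverts G"
    using in_arcsD2 by (auto simp: neighborhood_def)
  then show ?thesis
    using assms(2,3)
    by (force simp: local_inversion_def local_complement_def bicolorations_def PiE_def
          Pi_def extensional_def split: if_splits)
qed

end

theory Submission
  imports Defs "HOL-Library.Disjoint_Sets"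
begin

text \<open>
  It suffices to flip the colors on an arbitrary set \<open>X\<close> of vertices by a short string that
  restores the graph. Short strings do this for small sets: if \<open>a\<close> and \<open>b\<close> are adjacent,
  then \<open>ababab\<close> flips exactly \<open>{a, b}\<close>; if they have a common neighbor \<open>c\<close>, then they are
  adjacent in \<open>G\<close> or in the local complement at \<open>c\<close>, so that \<open>ababab\<close> or \<open>c ababab c\<close> does it;
  and a single vertex \<open>a\<close> with a neighbor \<open>b\<close> is flipped by \<open>b\<close> alone if \<open>b\<close> is a leaf, and by
  \<open>abacabc\<close> if \<open>b\<close> has another neighbor \<open>c\<close>. So a pair of vertices at distance at most 2 costs 8
  inversions and a single vertex costs 7.

  The strings are verified with one object. Inverting at \<open>v\<close> toggles the edges inside the
  neighborhood \<open>R\<close> of \<open>v\<close> and the colors on \<open>R\<close>, which means adding the rank one matrix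
  \<open>1\<^sub>R 1\<^sub>R\<^sup>T\<close> over the field of two elements to the matrix with the edges off the diagonal and the
  colors on it. A string flips exactly \<open>X\<close> when the matrices of its successive neighborhoods sum to
  the diagonal matrix of \<open>X\<close>.

  For general \<open>X\<close>, remove pairs at distance at most 2 until a set \<open>S\<close> is left whose closed
  neighborhoods are pairwise disjoint. This costs \<open>8 (\<bar>X\<bar> - \<bar>S\<bar>) / 2 + 7 \<bar>S\<bar> = 4 \<bar>X\<bar> + 3 \<bar>S\<bar>\<close>
  (\<open>flippable_by_packing\<close>). Connectivity gives every vertex a neighbor, so the closed
  neighborhoods have at least two elements and \<open>2 \<bar>S\<bar> \<le> n\<close> (\<open>card_packing_le\<close>). With
  \<open>\<bar>X\<bar> \<le> n - 1\<close> this is below \<open>(11 n - 3) / 2\<close>; if \<open>X\<close> contains all the vertices, removing one edge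
  first, at cost 6 instead of 8, makes up for the difference (\<open>flippable_set\<close>).
\<close>

section \<open>Neighborhoods under local complementation\<close>

lemma in_neighborhood_local_complement:
  "y \<in> neighborhood (local_complement G a) x \<longleftrightarrow>
    (y \<in> neighborhood G x) \<noteq> (x \<noteq> y \<and> x \<in> neighborhood G a \<and> y \<in> neighborhood G a)"
  by (auto simp: neighborhood_def local_complement_def neighbor_pairs_def)

lemma pverts_local_complement [simp]: "pverts (local_complement G a) = pverts G"
  by (simp add: local_complement_def)

lemma neighborhood_sym:
  assumes "pair_graph G"
  shows "x \<in> neighborhood G y \<longleftrightarrow> y \<in> neighborhood G x"
proof -
  interpret pair_graph G by fact
  show ?thesis using arcs_symmetric by (auto simp: neighborhood_def)
qed

lemma neighborhood_irrefl:
  assumes "pair_graph G" shows "x \<notin> neighborhood G x"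
proof -
  interpret pair_graph G by fact
  show ?thesis using no_loops' by (auto simp: neighborhood_def)
qed

lemma neighborhood_local_complement_same:
  assumes "pair_graph G"
  shows "neighborhood (local_complement G a) a = neighborhood G a"
  using neighborhood_irrefl[OF assms, of a] by (auto simp: in_neighborhood_local_complement)

lemma local_complement_involution:
  assumes "pair_graph G"
  shows "local_complement (local_complement G a) a = G"
proof -
  have "parcs (local_complement (local_complement G a) a) = parcs G"
    using neighborhood_local_complement_same[OF assms, of a]
    by (auto simp: local_complement_def neighbor_pairs_def neighborhood_def)
  then show ?thesis by (simp add: local_complement_def)
qed

lemma neighborhood_subset_pverts:
  assumes "pair_graph G"
  shows "neighborhood G a \<subseteq> pverts G"
proof -
  interpret pair_graph G by fact
  show ?thesis using in_arcsD2 by (auto simp: neighborhood_def)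
qed

lemma in_neighborhood_pverts:
  assumes "pair_graph G" "b \<in> neighborhood G a"
  shows "a \<in> pverts G" "b \<in> pverts G"
  using assms(2) neighborhood_sym[OF assms(1), of a b] neighborhood_subset_pverts[OF assms(1)]
  by blast+

lemma connected_imp_neighborhood_nonempty:
  assumes G: "pair_graph G" and con: "connected (with_proj G)" and n: "2 \<le> card (pverts G)"
    and x: "x \<in> pverts G"
  shows "neighborhood G x \<noteq> {}"
proof -
  interpret pair_graph G by fact
  have "\<not> card (pverts G) \<le> card {x}"
    using n by simp
  then have "\<not> pverts G \<subseteq> {x}"
    using card_mono[of "{x}" "pverts G"] by auto
  then obtain y where y: "y \<in> pverts G" "y \<noteq> x"
    by blast
  have "x \<rightarrow>\<^sup>*\<^bsub>mk_symmetric (with_proj G)\<^esub> y"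
    using con x y by (auto simp: connected_def strongly_connected_def)
  then have "x \<rightarrow>\<^sup>*\<^bsub>with_proj G\<^esub> y"
    using reachable_mk_symmetric_eq[OF sym_arcs] by simp
  then obtain w where "x \<rightarrow>\<^bsub>with_proj G\<^esub> w"
    using y(2) by (auto elim: converse_reachable_cases)
  then show ?thesis
    by (auto simp: neighborhood_def)
qed

section \<open>The change caused by a string\<close>

text \<open>
  With \<open>R\<^sub>i\<close> the neighborhood at which the \<open>i\<close>-th inversion of \<open>w\<close> acts, \<open>overlap G w x y\<close> is the
  parity of the number of \<open>i\<close> with \<open>{x, y} \<subseteq> R\<^sub>i\<close>. The case \<open>x = y\<close> is included on purpose: edges and
  colors then obey the same rule.
\<close>

fun overlap :: "'a pair_pre_digraph \<Rightarrow> 'a list \<Rightarrow> 'a \<Rightarrow> 'a \<Rightarrow> bool" where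
  "overlap G [] x y = False"
| "overlap G (a # w) x y =
    ((x \<in> neighborhood G a \<and> y \<in> neighborhood G a) \<noteq> overlap (local_complement G a) w x y)"

lemma local_inversions_append:
  "local_inversions B (u @ v) = local_inversions (local_inversions B u) v"
  by (simp add: local_inversions_def)

lemma local_inversions_Cons:
  "local_inversions (G, \<beta>) (a # w) =
    local_inversions (local_complement G a, \<lambda>x. if x \<in> neighborhood G a then - \<beta> x else \<beta> x) w"
  by (simp add: local_inversions_def local_inversion_def)

lemma local_inversions_overlap:
  "\<exists>H. pverts H = pverts G
    \<and> (\<forall>x y. y \<in> neighborhood H x \<longleftrightarrow> (y \<in> neighborhood G x) \<noteq> (x \<noteq> y \<and> overlap G w x y))
    \<and> local_inversions (G, \<beta>) w = (H, \<lambda>x. if overlap G w x x then - \<beta> x else \<beta> x)"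
proof (induction w arbitrary: G \<beta>)
  case Nil
  then show ?case by (simp add: local_inversions_Nil)
next
  case (Cons a w)
  let ?G = "local_complement G a" and ?\<beta> = "\<lambda>x. if x \<in> neighborhood G a then - \<beta> x else \<beta> x"
  obtain H where H: "pverts H = pverts ?G"
    "\<And>x y. y \<in> neighborhood H x \<longleftrightarrow> (y \<in> neighborhood ?G x) \<noteq> (x \<noteq> y \<and> overlap ?G w x y)"
    "local_inversions (?G, ?\<beta>) w = (H, \<lambda>x. if overlap ?G w x x then - ?\<beta> x else ?\<beta> x)"
    using Cons.IH[of ?G ?\<beta>] by blast
  show ?case
  proof (intro exI conjI allI)
    show "pverts H = pverts G"
      using H(1) by simp
    show "y \<in> neighborhood H x \<longleftrightarrow> (y \<in> neighborhood G x) \<noteq> (x \<noteq> y \<and> overlap G (a # w) x y)" for x y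
      unfolding H(2) in_neighborhood_local_complement overlap.simps by argo
    show "local_inversions (G, \<beta>) (a # w)
        = (H, \<lambda>x. if overlap G (a # w) x x then - \<beta> x else \<beta> x)"
      unfolding local_inversions_Cons H(3) by (auto simp: fun_eq_iff)
  qed
qed

definition flips_exactly :: "'a pair_pre_digraph \<Rightarrow> 'a list \<Rightarrow> 'a set \<Rightarrow> bool" where
  "flips_exactly G w X \<longleftrightarrow>
    (\<forall>\<beta>. local_inversions (G, \<beta>) w = (G, \<lambda>x. if x \<in> X then - \<beta> x else \<beta> x))"

text \<open>
  Off the diagonal the criterion says that all edges are restored, and on the diagonal that the
  colors change exactly on \<open>X\<close>.
\<close>

lemma flips_exactlyI:
  assumes "\<And>x y. overlap G w x y \<longleftrightarrow> x = y \<and> x \<in> X"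
  shows "flips_exactly G w X"
  unfolding flips_exactly_def
proof
  fix \<beta>
  obtain H where H: "pverts H = pverts G"
    "\<And>x y. y \<in> neighborhood H x \<longleftrightarrow> (y \<in> neighborhood G x) \<noteq> (x \<noteq> y \<and> overlap G w x y)"
    "local_inversions (G, \<beta>) w = (H, \<lambda>x. if overlap G w x x then - \<beta> x else \<beta> x)"
    using local_inversions_overlap[of G w \<beta>] by blast
  have "parcs H = parcs G"
    using H(2) by (auto simp: assms neighborhood_def)
  with H(1) have "H = G" by simp
  with H(3) show "local_inversions (G, \<beta>) w = (G, \<lambda>x. if x \<in> X then - \<beta> x else \<beta> x)"
    by (simp add: assms)
qed

lemma flips_exactly_Un:
  assumes "flips_exactly G u X" "flips_exactly G v Y" "X \<inter> Y = {}"
  shows "flips_exactly G (u @ v) (X \<union> Y)"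
  using assms unfolding flips_exactly_def local_inversions_append by (auto simp: fun_eq_iff)

text \<open>
  The neighborhood of \<open>c\<close> is the same in \<open>G\<close> and in its local complement at \<open>c\<close>, so the two outer
  inversions cancel both in the graph and in the coloring.
\<close>

lemma flips_exactly_conjugate:
  assumes G: "pair_graph G" and w: "flips_exactly (local_complement G c) w X"
  shows "flips_exactly G (c # w @ [c]) X"
proof -
  have "local_inversions (G, \<beta>) (c # w @ [c]) = (G, \<lambda>x. if x \<in> X then - \<beta> x else \<beta> x)" for \<beta>
    using w unfolding flips_exactly_def local_inversions_Cons local_inversions_snoc
    by (auto simp: local_inversion_def fun_eq_iff local_complement_involution[OF G]
        neighborhood_local_complement_same[OF G])
  then show ?thesis by (simp add: flips_exactly_def)
qed

section \<open>Strings that flip one or two vertices\<close>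

text \<open>
  Outside \<open>{a, b}\<close> the six neighborhoods are \<open>A\<close>, \<open>A + B\<close>, \<open>B\<close>, \<open>A\<close>, \<open>A + B\<close>, \<open>B\<close>, where \<open>+\<close> is the
  symmetric difference. Each occurs twice, so that their contributions cancel.
\<close>

lemma flips_edge:
  assumes G: "pair_graph G" and ab: "b \<in> neighborhood G a"
  shows "flips_exactly G [a, b, a, b, a, b] {a, b}"
proof (rule flips_exactlyI)
  define A B where "A = neighborhood G a" and "B = neighborhood G b"
  define G1 G2 G3 G4 G5 where "G1 = local_complement G a" and "G2 = local_complement G1 b"
    and "G3 = local_complement G2 a" and "G4 = local_complement G3 b"
    and "G5 = local_complement G4 a"
  note defs = G1_def G2_def G3_def G4_def G5_def
  have base: "a \<notin> A" "b \<in> A" "a \<in> B" "b \<notin> B" "a \<noteq> b"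
    using ab neighborhood_sym[OF G, of a b] neighborhood_irrefl[OF G]
    unfolding A_def B_def by auto
  have R0: "x \<in> neighborhood G a \<longleftrightarrow> x \<in> A" "x \<in> neighborhood G b \<longleftrightarrow> x \<in> B" for x
    by (auto simp: A_def B_def)
  note step = in_neighborhood_local_complement
  have R1:
    "x \<in> neighborhood G1 a \<longleftrightarrow> (if x \<in> {a, b} then x = b else x \<in> A)"
    "x \<in> neighborhood G1 b \<longleftrightarrow> (if x \<in> {a, b} then x = a else (x \<in> A) \<noteq> (x \<in> B))" for x
    using base unfolding G1_def step R0 by auto
  have R2:
    "x \<in> neighborhood G2 a \<longleftrightarrow> (if x \<in> {a, b} then x = b else x \<in> B)"
    "x \<in> neighborhood G2 b \<longleftrightarrow> (if x \<in> {a, b} then x = a else (x \<in> A) \<noteq> (x \<in> B))" for x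
    using base unfolding G2_def step R1 by auto
  have R3:
    "x \<in> neighborhood G3 a \<longleftrightarrow> (if x \<in> {a, b} then x = b else x \<in> B)"
    "x \<in> neighborhood G3 b \<longleftrightarrow> (if x \<in> {a, b} then x = a else x \<in> A)" for x
    using base unfolding G3_def step R2 by auto
  have R4:
    "x \<in> neighborhood G4 a \<longleftrightarrow> (if x \<in> {a, b} then x = b else (x \<in> A) \<noteq> (x \<in> B))"
    "x \<in> neighborhood G4 b \<longleftrightarrow> (if x \<in> {a, b} then x = a else x \<in> A)" for x
    using base unfolding G4_def step R3 by auto
  have R5:
    "x \<in> neighborhood G5 a \<longleftrightarrow> (if x \<in> {a, b} then x = b else (x \<in> A) \<noteq> (x \<in> B))"
    "x \<in> neighborhood G5 b \<longleftrightarrow> (if x \<in> {a, b} then x = a else x \<in> B)" for x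
    using base unfolding G5_def step R4 by auto
  show "overlap G [a, b, a, b, a, b] x y \<longleftrightarrow> x = y \<and> x \<in> {a, b}" for x y
    unfolding overlap.simps defs[symmetric] R0 R1 R2 R3 R4 R5 using base by auto
qed

text \<open>
  Let \<open>A\<close>, \<open>B\<close>, \<open>C\<close> be the neighborhoods of \<open>a\<close>, \<open>b\<close>, \<open>c\<close>. Outside \<open>{a, b, c}\<close>, each of the seven
  neighborhoods met by \<open>abacabc\<close> is a nonempty sum of \<open>A\<close>, \<open>B\<close>, \<open>C\<close>, and each of the seven nonempty
  sums occurs exactly once. Hence vertices \<open>x\<close> and \<open>y\<close> outside \<open>{a, b, c}\<close>, equal or not, lie together
  in an even number of them: two nonzero vectors of \<open>GF(2)\<^sup>3\<close> are both mapped to 1 by four of the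
  seven nonzero linear functionals if they are equal, and by two if they differ. This holds whether
  or not \<open>a\<close> and \<open>c\<close> are adjacent, but the sums come in a different order in the two cases.
\<close>

lemma flips_end_of_induced_path:
  assumes G: "pair_graph G" and ab: "b \<in> neighborhood G a" and bc: "c \<in> neighborhood G b"
    and ac: "c \<notin> neighborhood G a" "a \<noteq> c"
  shows "flips_exactly G [a, b, a, c, a, b, c] {a}"
proof (rule flips_exactlyI)
  define A B C where "A = neighborhood G a" and "B = neighborhood G b" and "C = neighborhood G c"
  define G1 G2 G3 G4 G5 G6 where "G1 = local_complement G a" and "G2 = local_complement G1 b"
    and "G3 = local_complement G2 a" and "G4 = local_complement G3 c"
    and "G5 = local_complement G4 a" and "G6 = local_complement G5 b"
  note defs = G1_def G2_def G3_def G4_def G5_def G6_def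
  have base: "a \<notin> A" "b \<in> A" "c \<notin> A" "a \<in> B" "b \<notin> B" "c \<in> B"
    "a \<notin> C" "b \<in> C" "c \<notin> C" "a \<noteq> b" "b \<noteq> c" "a \<noteq> c"
    using assms neighborhood_sym[OF G] neighborhood_irrefl[OF G]
    unfolding A_def B_def C_def by auto
  have R0: "x \<in> neighborhood G a \<longleftrightarrow> x \<in> A" "x \<in> neighborhood G b \<longleftrightarrow> x \<in> B"
    "x \<in> neighborhood G c \<longleftrightarrow> x \<in> C" for x
    by (auto simp: A_def B_def C_def)
  note step = in_neighborhood_local_complement
  have R1:
    "x \<in> neighborhood G1 a \<longleftrightarrow> (if x \<in> {a, b, c} then x \<in> {b} else x \<in> A)"
    "x \<in> neighborhood G1 b \<longleftrightarrow> (if x \<in> {a, b, c} then x \<in> {a, c} else (x \<in> A) \<noteq> (x \<in> B))"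
    "x \<in> neighborhood G1 c \<longleftrightarrow> (if x \<in> {a, b, c} then x \<in> {b} else x \<in> C)" for x
    using base unfolding G1_def step R0 by auto
  have R2:
    "x \<in> neighborhood G2 a \<longleftrightarrow> (if x \<in> {a, b, c} then x \<in> {b, c} else x \<in> B)"
    "x \<in> neighborhood G2 b \<longleftrightarrow> (if x \<in> {a, b, c} then x \<in> {a, c} else (x \<in> A) \<noteq> (x \<in> B))"
    "x \<in> neighborhood G2 c \<longleftrightarrow> (if x \<in> {a, b, c} then x \<in> {a, b} else ((x \<in> A) \<noteq> (x \<in> B)) \<noteq> (x \<in> C))" for x
    using base unfolding G2_def step R1 by auto
  have R3:
    "x \<in> neighborhood G3 a \<longleftrightarrow> (if x \<in> {a, b, c} then x \<in> {b, c} else x \<in> B)"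
    "x \<in> neighborhood G3 b \<longleftrightarrow> (if x \<in> {a, b, c} then x \<in> {a} else x \<in> A)"
    "x \<in> neighborhood G3 c \<longleftrightarrow> (if x \<in> {a, b, c} then x \<in> {a} else (x \<in> A) \<noteq> (x \<in> C))" for x
    using base unfolding G3_def step R2 by auto
  have R4:
    "x \<in> neighborhood G4 a \<longleftrightarrow> (if x \<in> {a, b, c} then x \<in> {b, c} else ((x \<in> A) \<noteq> (x \<in> B)) \<noteq> (x \<in> C))"
    "x \<in> neighborhood G4 b \<longleftrightarrow> (if x \<in> {a, b, c} then x \<in> {a} else x \<in> A)"
    "x \<in> neighborhood G4 c \<longleftrightarrow> (if x \<in> {a, b, c} then x \<in> {a} else (x \<in> A) \<noteq> (x \<in> C))" for x
    using base unfolding G4_def step R3 by auto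
  have R5:
    "x \<in> neighborhood G5 a \<longleftrightarrow> (if x \<in> {a, b, c} then x \<in> {b, c} else ((x \<in> A) \<noteq> (x \<in> B)) \<noteq> (x \<in> C))"
    "x \<in> neighborhood G5 b \<longleftrightarrow> (if x \<in> {a, b, c} then x \<in> {a, c} else (x \<in> B) \<noteq> (x \<in> C))"
    "x \<in> neighborhood G5 c \<longleftrightarrow> (if x \<in> {a, b, c} then x \<in> {a, b} else x \<in> B)" for x
    using base unfolding G5_def step R4 by auto
  have R6:
    "x \<in> neighborhood G6 a \<longleftrightarrow> (if x \<in> {a, b, c} then x \<in> {b} else x \<in> A)"
    "x \<in> neighborhood G6 b \<longleftrightarrow> (if x \<in> {a, b, c} then x \<in> {a, c} else (x \<in> B) \<noteq> (x \<in> C))"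
    "x \<in> neighborhood G6 c \<longleftrightarrow> (if x \<in> {a, b, c} then x \<in> {b} else x \<in> C)" for x
    using base unfolding G6_def step R5 by auto
  show "overlap G [a, b, a, c, a, b, c] x y \<longleftrightarrow> x = y \<and> x \<in> {a}" for x y
    unfolding overlap.simps defs[symmetric] R0 R1 R2 R3 R4 R5 R6
    using base by (cases "x \<in> {a, b, c}"; cases "y \<in> {a, b, c}") auto
qed

lemma flips_vertex_of_triangle:
  assumes G: "pair_graph G" and ab: "b \<in> neighborhood G a" and bc: "c \<in> neighborhood G b"
    and ac: "c \<in> neighborhood G a"
  shows "flips_exactly G [a, b, a, c, a, b, c] {a}"
proof (rule flips_exactlyI)
  define A B C where "A = neighborhood G a" and "B = neighborhood G b" and "C = neighborhood G c"
  define G1 G2 G3 G4 G5 G6 where "G1 = local_complement G a" and "G2 = local_complement G1 b"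
    and "G3 = local_complement G2 a" and "G4 = local_complement G3 c"
    and "G5 = local_complement G4 a" and "G6 = local_complement G5 b"
  note defs = G1_def G2_def G3_def G4_def G5_def G6_def
  have base: "a \<notin> A" "b \<in> A" "c \<in> A" "a \<in> B" "b \<notin> B" "c \<in> B"
    "a \<in> C" "b \<in> C" "c \<notin> C" "a \<noteq> b" "b \<noteq> c" "a \<noteq> c"
    using assms neighborhood_sym[OF G] neighborhood_irrefl[OF G]
    unfolding A_def B_def C_def by auto
  have R0: "x \<in> neighborhood G a \<longleftrightarrow> x \<in> A" "x \<in> neighborhood G b \<longleftrightarrow> x \<in> B"
    "x \<in> neighborhood G c \<longleftrightarrow> x \<in> C" for x
    by (auto simp: A_def B_def C_def)
  note step = in_neighborhood_local_complement
  have R1: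
    "x \<in> neighborhood G1 a \<longleftrightarrow> (if x \<in> {a, b, c} then x \<in> {b, c} else x \<in> A)"
    "x \<in> neighborhood G1 b \<longleftrightarrow> (if x \<in> {a, b, c} then x \<in> {a} else (x \<in> A) \<noteq> (x \<in> B))"
    "x \<in> neighborhood G1 c \<longleftrightarrow> (if x \<in> {a, b, c} then x \<in> {a} else (x \<in> A) \<noteq> (x \<in> C))" for x
    using base unfolding G1_def step R0 by auto
  have R2:
    "x \<in> neighborhood G2 a \<longleftrightarrow> (if x \<in> {a, b, c} then x \<in> {b, c} else x \<in> B)"
    "x \<in> neighborhood G2 b \<longleftrightarrow> (if x \<in> {a, b, c} then x \<in> {a} else (x \<in> A) \<noteq> (x \<in> B))"
    "x \<in> neighborhood G2 c \<longleftrightarrow> (if x \<in> {a, b, c} then x \<in> {a} else (x \<in> A) \<noteq> (x \<in> C))" for x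
    using base unfolding G2_def step R1 by auto
  have R3:
    "x \<in> neighborhood G3 a \<longleftrightarrow> (if x \<in> {a, b, c} then x \<in> {b, c} else x \<in> B)"
    "x \<in> neighborhood G3 b \<longleftrightarrow> (if x \<in> {a, b, c} then x \<in> {a, c} else x \<in> A)"
    "x \<in> neighborhood G3 c \<longleftrightarrow> (if x \<in> {a, b, c} then x \<in> {a, b} else ((x \<in> A) \<noteq> (x \<in> B)) \<noteq> (x \<in> C))" for x
    using base unfolding G3_def step R2 by auto
  have R4:
    "x \<in> neighborhood G4 a \<longleftrightarrow> (if x \<in> {a, b, c} then x \<in> {c} else (x \<in> A) \<noteq> (x \<in> C))"
    "x \<in> neighborhood G4 b \<longleftrightarrow> (if x \<in> {a, b, c} then x \<in> {c} else (x \<in> B) \<noteq> (x \<in> C))"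
    "x \<in> neighborhood G4 c \<longleftrightarrow> (if x \<in> {a, b, c} then x \<in> {a, b} else ((x \<in> A) \<noteq> (x \<in> B)) \<noteq> (x \<in> C))" for x
    using base unfolding G4_def step R3 by auto
  have R5:
    "x \<in> neighborhood G5 a \<longleftrightarrow> (if x \<in> {a, b, c} then x \<in> {c} else (x \<in> A) \<noteq> (x \<in> C))"
    "x \<in> neighborhood G5 b \<longleftrightarrow> (if x \<in> {a, b, c} then x \<in> {c} else (x \<in> B) \<noteq> (x \<in> C))"
    "x \<in> neighborhood G5 c \<longleftrightarrow> (if x \<in> {a, b, c} then x \<in> {a, b} else x \<in> B)" for x
    using base unfolding G5_def step R4 by auto
  have R6:
    "x \<in> neighborhood G6 a \<longleftrightarrow> (if x \<in> {a, b, c} then x \<in> {c} else (x \<in> A) \<noteq> (x \<in> C))"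
    "x \<in> neighborhood G6 b \<longleftrightarrow> (if x \<in> {a, b, c} then x \<in> {c} else (x \<in> B) \<noteq> (x \<in> C))"
    "x \<in> neighborhood G6 c \<longleftrightarrow> (if x \<in> {a, b, c} then x \<in> {a, b} else x \<in> C)" for x
    using base unfolding G6_def step R5 by auto
  show "overlap G [a, b, a, c, a, b, c] x y \<longleftrightarrow> x = y \<and> x \<in> {a}" for x y
    unfolding overlap.simps defs[symmetric] R0 R1 R2 R3 R4 R5 R6
    using base by (cases "x \<in> {a, b, c}"; cases "y \<in> {a, b, c}") auto
qed


section \<open>The cost of a set of vertices\<close>

definition flippable :: "'a pair_pre_digraph \<Rightarrow> 'a set \<Rightarrow> nat \<Rightarrow> bool" where
  "flippable G X k \<longleftrightarrow>
    (\<exists>w. set w \<subseteq> pverts G \<and> length w \<le> k \<and> flips_exactly G w X)"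

lemma flippableI:
  assumes "flips_exactly G w X" "set w \<subseteq> pverts G" "length w \<le> k"
  shows "flippable G X k"
  using assms by (auto simp: flippable_def)

lemma flippable_mono: "flippable G X k \<Longrightarrow> k \<le> l \<Longrightarrow> flippable G X l"
  by (auto simp: flippable_def intro: le_trans)

lemma flippable_empty: "flippable G {} 0"
  by (rule flippableI[of _ "[]"]) (simp_all add: flips_exactly_def local_inversions_Nil)

lemma flippable_Un:
  assumes "flippable G X k" "flippable G Y l" "X \<inter> Y = {}"
  shows "flippable G (X \<union> Y) (k + l)"
proof -
  obtain u v where "set u \<subseteq> pverts G" "length u \<le> k" "flips_exactly G u X"
    "set v \<subseteq> pverts G" "length v \<le> l" "flips_exactly G v Y"
    using assms(1,2) by (auto simp: flippable_def)
  then show ?thesis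
    using assms(3) by (intro flippableI[of _ "u @ v"] flips_exactly_Un) auto
qed

lemma flippable_edge:
  assumes "pair_graph G" "b \<in> neighborhood G a"
  shows "flippable G {a, b} 6"
  using flips_edge[OF assms] in_neighborhood_pverts[OF assms] by (auto intro: flippableI)

text \<open>
  Two nonadjacent neighbors of \<open>c\<close> become adjacent in the local complement at \<open>c\<close>, where the string
  of \<open>flips_edge\<close> applies; a second inversion at \<open>c\<close> undoes the first.
\<close>

lemma flippable_common_neighbor:
  assumes G: "pair_graph G" and "a \<in> neighborhood G c" "b \<in> neighborhood G c" "a \<noteq> b"
  shows "flippable G {a, b} 8"
proof (cases "b \<in> neighborhood G a")
  case True
  then show ?thesis
    using flippable_edge[OF G] flippable_mono by fastforce
next
  case False
  with assms have "b \<in> neighborhood (local_complement G c) a"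
    by (simp add: in_neighborhood_local_complement)
  then have "flips_exactly (local_complement G c) [a, b, a, b, a, b] {a, b}"
    by (rule flips_edge[OF pair_graph_local_complement[OF G]])
  then have "flips_exactly G (c # [a, b, a, b, a, b] @ [c]) {a, b}"
    by (rule flips_exactly_conjugate[OF G])
  then show ?thesis
    by (rule flippableI)
      (use in_neighborhood_pverts[OF G assms(2)] in_neighborhood_pverts[OF G assms(3)] in auto)
qed

text \<open>
  If \<open>b\<close> is a leaf, then the local complement at \<open>b\<close> is \<open>G\<close> itself and only the color of \<open>a\<close>
  changes. Otherwise a second neighbor of \<open>b\<close> is available as \<open>c\<close>.
\<close>

lemma flippable_vertex:
  assumes G: "pair_graph G" and ab: "b \<in> neighborhood G a"
  shows "flippable G {a} 7"
proof (cases "neighborhood G b = {a}")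
  case True
  then have "overlap G [b] x y \<longleftrightarrow> x = y \<and> x \<in> {a}" for x y
    by auto
  then have "flips_exactly G [b] {a}"
    by (rule flips_exactlyI)
  then show ?thesis
    by (rule flippableI) (use in_neighborhood_pverts[OF G ab] in auto)
next
  case False
  then obtain c where c: "c \<in> neighborhood G b" "a \<noteq> c"
    using ab neighborhood_sym[OF G, of a b] by blast
  have "flips_exactly G [a, b, a, c, a, b, c] {a}"
    using flips_end_of_induced_path[OF G ab c(1)] flips_vertex_of_triangle[OF G ab c(1)] c(2)
    by blast
  then show ?thesis
    by (rule flippableI)
      (use in_neighborhood_pverts[OF G ab] in_neighborhood_pverts[OF G c(1)] in auto)
qed

lemma flippable_vertexwise:
  assumes "finite X" "\<And>x. x \<in> X \<Longrightarrow> flippable G {x} k"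
  shows "flippable G X (k * card X)"
  using assms
proof (induction X)
  case empty
  then show ?case by (simp add: flippable_empty)
next
  case (insert x X)
  then have "flippable G ({x} \<union> X) (k + k * card X)"
    by (intro flippable_Un) auto
  with insert show ?case by simp
qed

section \<open>Packing closed neighborhoods\<close>

abbreviation closed_neighborhood :: "'a pair_pre_digraph \<Rightarrow> 'a \<Rightarrow> 'a set" where
  "closed_neighborhood G x \<equiv> insert x (neighborhood G x)"

lemma flippable_close_pair:
  assumes G: "pair_graph G" and "x \<noteq> y"
    and "closed_neighborhood G x \<inter> closed_neighborhood G y \<noteq> {}"
  shows "flippable G {x, y} 8"
proof (cases "y \<in> neighborhood G x")
  case True
  then show ?thesis
    using flippable_edge[OF G] flippable_mono by fastforce
next
  case False
  with assms obtain c where "c \<in> neighborhood G x" "c \<in> neighborhood G y"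
    using neighborhood_sym[OF G, of x y] by blast
  then show ?thesis
    using flippable_common_neighbor[OF G, of x c y] \<open>x \<noteq> y\<close>
      neighborhood_sym[OF G, of c x] neighborhood_sym[OF G, of c y] by blast
qed

text \<open>
  Two vertices of \<open>X\<close> whose closed neighborhoods meet are adjacent or have a common neighbor, so
  they can be removed at cost 8, that is 4 each. When no such pair is left, the remaining vertices
  form \<open>S\<close> and are flipped one by one, at cost \<open>7 = 4 + 3\<close> each.
\<close>

lemma flippable_by_packing:
  assumes G: "pair_graph G" and no_isolated: "\<And>x. x \<in> pverts G \<Longrightarrow> neighborhood G x \<noteq> {}"
    and "X \<subseteq> pverts G"
  shows "\<exists>S \<subseteq> X. disjoint_family_on (closed_neighborhood G) S
    \<and> flippable G X (4 * card X + 3 * card S)"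
proof -
  interpret pair_graph G by fact
  have "finite X"
    using finite_subset[OF \<open>X \<subseteq> pverts G\<close>] by simp
  then show ?thesis
    using \<open>X \<subseteq> pverts G\<close>
  proof (induction X rule: finite_psubset_induct)
    case (psubset X)
    show ?case
    proof (cases "disjoint_family_on (closed_neighborhood G) X")
      case True
      have "flippable G X (7 * card X)"
      proof (rule flippable_vertexwise)
        fix x assume "x \<in> X"
        with psubset.prems no_isolated obtain y where "y \<in> neighborhood G x"
          by blast
        then show "flippable G {x} 7"
          by (rule flippable_vertex[OF G])
      qed (rule psubset.hyps)
      with True show ?thesis by auto
    next
      case False
      then obtain x y where xy: "x \<in> X" "y \<in> X" "x \<noteq> y"
        "closed_neighborhood G x \<inter> closed_neighborhood G y \<noteq> {}"
        by (auto simp: disjoint_family_on_def)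
      then obtain S where S: "S \<subseteq> X - {x, y}" "disjoint_family_on (closed_neighborhood G) S"
        "flippable G (X - {x, y}) (4 * card (X - {x, y}) + 3 * card S)"
        using psubset.IH[of "X - {x, y}"] psubset.prems by blast
      have "flippable G ({x, y} \<union> (X - {x, y})) (8 + (4 * card (X - {x, y}) + 3 * card S))"
        using flippable_close_pair[OF G xy(3,4)] S(3) by (rule flippable_Un) auto
      moreover have "{x, y} \<union> (X - {x, y}) = X"
        using xy by auto
      moreover have "card X = card (X - {x, y}) + 2"
        using card_Diff_subset[of "{x, y}" X] card_mono[OF psubset.hyps, of "{x, y}"] xy by simp
      ultimately have "flippable G X (4 * card X + 3 * card S)"
        by (simp add: algebra_simps)
      with S(1,2) show ?thesis by blast
    qed
  qed
qed

lemma card_packing_le: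
  assumes G: "pair_graph G" and no_isolated: "\<And>x. x \<in> pverts G \<Longrightarrow> neighborhood G x \<noteq> {}"
    and S: "S \<subseteq> pverts G" "disjoint_family_on (closed_neighborhood G) S"
  shows "2 * card S \<le> card (pverts G)"
proof -
  interpret pair_graph G by fact
  have finV: "finite (pverts G)" by simp
  have sub: "closed_neighborhood G x \<subseteq> pverts G" if "x \<in> S" for x
    using that S(1) neighborhood_subset_pverts[OF G] by blast
  have fin: "finite (closed_neighborhood G x)" if "x \<in> S" for x
    using finite_subset[OF sub[OF that] finV] .
  have ge2: "2 \<le> card (closed_neighborhood G x)" if "x \<in> S" for x
  proof -
    have "x \<in> pverts G" using that S(1) by blast
    with no_isolated obtain y where y: "y \<in> neighborhood G x" by blast
    with neighborhood_irrefl[OF G, of x] have "x \<noteq> y" by metis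
    then have "card {x, y} = 2" by simp
    moreover have "card {x, y} \<le> card (closed_neighborhood G x)"
      using y by (intro card_mono fin[OF that]) auto
    ultimately show ?thesis by simp
  qed
  have finS: "finite S" using finite_subset[OF S(1) finV] .
  have "2 * card S = (\<Sum>x\<in>S. 2)" by simp
  also have "\<dots> \<le> (\<Sum>x\<in>S. card (closed_neighborhood G x))"
    by (rule sum_mono) (rule ge2)
  also have "\<dots> = card (\<Union>x\<in>S. closed_neighborhood G x)"
    using finS fin S(2) by (subst card_UN_disjoint) (auto simp: disjoint_family_on_def)
  also have "\<dots> \<le> card (pverts G)"
    by (rule card_mono[OF finV]) (use sub in blast)
  finally show ?thesis .
qed

text \<open>
  The packing bound \<open>4 \<bar>X\<bar> + 3 \<bar>S\<bar>\<close>, doubled, is at most \<open>8 (n - 1) + 3 n = 11 n - 8\<close> for a proper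
  subset \<open>X\<close>. For the whole vertex set it could reach \<open>11 n\<close>; flipping one edge separately at cost 6
  lowers the doubled bound to \<open>12 + 8 (n - 2) + 3 n = 11 n - 4\<close>.
\<close>

lemma flippable_set:
  assumes G: "pair_graph G" and no_isolated: "\<And>x. x \<in> pverts G \<Longrightarrow> neighborhood G x \<noteq> {}"
    and X: "X \<subseteq> pverts G" and nonempty: "pverts G \<noteq> {}"
  shows "\<exists>k. 2 * k + 3 \<le> 11 * card (pverts G) \<and> flippable G X k"
proof -
  interpret pair_graph G by fact
  let ?n = "card (pverts G)"
  have fin: "finite (pverts G)" by simp
  show ?thesis
  proof (cases "X = pverts G")
    case False
    obtain S where S: "S \<subseteq> X" "disjoint_family_on (closed_neighborhood G) S"
      "flippable G X (4 * card X + 3 * card S)"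
      using flippable_by_packing[OF G no_isolated X] by blast
    have "card X < ?n"
      using X False by (simp add: psubset_card_mono psubset_eq)
    moreover have "2 * card S \<le> ?n"
      using S(1,2) X by (intro card_packing_le[OF G no_isolated]) auto
    ultimately have "2 * (4 * card X + 3 * card S) + 3 \<le> 11 * ?n"
      by simp
    with S(3) show ?thesis by blast
  next
    case True
    obtain a b where ab: "b \<in> neighborhood G a"
      using nonempty no_isolated by blast
    then have V: "a \<in> pverts G" "b \<in> pverts G" "a \<noteq> b"
      using in_neighborhood_pverts[OF G ab] neighborhood_irrefl[OF G, of a] by auto
    let ?X = "pverts G - {a, b}"
    obtain S where S: "S \<subseteq> ?X" "disjoint_family_on (closed_neighborhood G) S"
      "flippable G ?X (4 * card ?X + 3 * card S)"
      using flippable_by_packing[OF G no_isolated, of ?X] by blast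
    have "flippable G ({a, b} \<union> ?X) (6 + (4 * card ?X + 3 * card S))"
      using flippable_edge[OF G ab] S(3) by (rule flippable_Un) auto
    moreover have "{a, b} \<union> ?X = X"
      using V True by auto
    ultimately have "flippable G X (6 + (4 * card ?X + 3 * card S))"
      by metis
    moreover have "?n = card ?X + 2"
      using card_Diff_subset[of "{a, b}" "pverts G"] card_mono[OF fin, of "{a, b}"] V by simp
    moreover have "2 * card S \<le> ?n"
      using S(1,2) by (intro card_packing_le[OF G no_isolated]) auto
    then have "2 * (6 + (4 * card ?X + 3 * card S)) + 3 \<le> 11 * ?n"
      using \<open>?n = card ?X + 2\<close> by simp
    ultimately show ?thesis by blast
  qed
qed

theorem theorem2:
  fixes G :: "'a pair_pre_digraph" and \<beta> \<beta>' :: "'a \<Rightarrow> int" and n :: nat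
  assumes "pair_graph G"
    and "connected (with_proj G)"
    and "n = card (pverts G)"
    and "n \<ge> 2"
    and "\<beta> \<in> bicolorations G"
    and "\<beta>' \<in> bicolorations G"
  shows "\<exists>w :: 'a list. set w \<subseteq> pverts G
    \<and> int (length w) \<le> \<lfloor>(11 * real n - 3) / 2\<rfloor>
    \<and> local_inversions (G, \<beta>) w = (G, \<beta>')"
proof -
  let ?X = "{x \<in> pverts G. \<beta> x \<noteq> \<beta>' x}"
  have "pverts G \<noteq> {}"
    using assms(3,4) by auto
  then obtain k where k: "2 * k + 3 \<le> 11 * n" "flippable G ?X k"
    using flippable_set[OF assms(1) connected_imp_neighborhood_nonempty[OF assms(1,2)], of ?X]
      assms(3,4) by auto
  then obtain w where w: "set w \<subseteq> pverts G" "length w \<le> k" "flips_exactly G w ?X"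
    by (auto simp: flippable_def)
  have "(if x \<in> ?X then - \<beta> x else \<beta> x) = \<beta>' x" for x
  proof (cases "x \<in> pverts G")
    case True
    then have "\<beta> x \<in> {-1, 1}" "\<beta>' x \<in> {-1, 1}"
      using assms(5,6) by (auto simp: bicolorations_def)
    with True show ?thesis by auto
  next
    case False
    then show ?thesis
      using assms(5,6) by (auto simp: bicolorations_def PiE_def extensional_def)
  qed
  then have "local_inversions (G, \<beta>) w = (G, \<beta>')"
    using w(3) unfolding flips_exactly_def by presburger
  moreover have "2 * real (length w) \<le> 11 * real n - 3"
    using k(1) w(2) by linarith
  then have "int (length w) \<le> \<lfloor>(11 * real n - 3) / 2\<rfloor>"
    by (simp add: le_floor_iff)
  ultimately show ?thesis
    using w(1) by blast
qed

end
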